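(* Consider on $\mathbb{R}^3$ the singular Nambu-Poisson structure of order $3$ $$\Lambda=(x_1^2+x_2^2+x_3^2)\frac{\partial}{\partial x_1}\wedge\frac{\partial}{\partial x_2}\wedge\frac{\partial}{\partial x_3}.$$ Then $$H^1_{NP}(\mathbb{R}^3)\not\cong H^{canNP}_2(\mathbb{R}^3),$$ and therefore the duality between the Nambu-Poisson cohomology and the canonical Nambu-Poisson homology (that is, $H^k_{NP}\cong H^{canNP}_{3-k}$ for all $k\in\{0,\dots,3\}$) does not hold for $(\mathbb{R}^3,\Lambda)$.
   Context: $(x_1,x_2,x_3)$ are the usual coordinates on $M=\mathbb{R}^3$, $\Omega^k(M)$ the $k$-forms, $\mathcal{V}^k(M)$ the $k$-vector fields, $n=3$. Contractions are in the first slots: $i(\alpha_1\wedge\dots\wedge\alpha_k)P=P(\alpha_1,\dots,\alpha_k,\cdot,\dots)$ and $i(X_1\wedge\dots\wedge X_k)\omega=\omega(X_1,\dots,X_k,\cdot,\dots)$. $\#_k:\Omega^k(M)\to\mathcal{V}^{3-k}(M)$ is $\#_k(\beta)=i(\beta)\Lambda$. Nambu-Poisson cohomology $H^*_{NP}(M)$. Let $[\![\alpha,\beta]\!]=\mathcal{L}_{\#_2(\alpha)}\beta-\#_3(d\alpha)\beta$ on $\Omega^2(M)$; it induces a Lie bracket on $\Omega^2(M)/\ker\#_2$. The $k$-cochains are the skew-symmetric $C^\infty(M,\mathbb{R})$-multilinear maps $c^k:(\Omega^2(M)/\ker\#_2)^k\to C^\infty(M,\mathbb{R})$ (functions for $k=0$),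 with $$\tilde\partial c^k([\alpha_0],\dots,[\alpha_k])=\sum_{i=0}^k(-1)^i\#_2(\alpha_i)\big(c^k([\alpha_0],\dots,\widehat{[\alpha_i]},\dots,[\alpha_k])\big)+\sum_{0\le i<j\le k}(-1)^{i-1}c^k([\alpha_0],\dots,\widehat{[\alpha_i]},\dots,[\alpha_{j-1}],[[\![\alpha_i,\alpha_j]\!]],[\alpha_{j+1}],\dots,[\alpha_k]).$$ $H^*_{NP}(M)$ is the cohomology of this complex. Canonical Nambu-Poisson homology $H^{canNP}_*(M)$. Fix the volume form $\nu=dx_1\wedge dx_2\wedge dx_3$ (the homology is independent of this choice up to isomorphism); $\flat_\nu(P)=i(P)\nu$ and $\delta_\nu=\flat_\nu^{-1}\circ d\circ\flat_\nu:\mathcal{V}^k(M)\to\mathcal{V}^{k-1}(M)$. Let $\mathcal{V}^0_t(M,\Lambda)=C^\infty(M,\mathbb{R})$ and, for $1\le k\le 3$, $\mathcal{V}^k_t(M,\Lambda)=\{P\in\mathcal{V}^k(M): i(\alpha)P=0\text{ for all }\alpha\in\Omega^1(M)\text{ with }\#_1(\alpha)=0\}$. $H^{canNP}_*(M)$ is the homology of the complex $(\mathcal{V}^*_t(M,\Lambda),\delta_\nu)$. *)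

theory Defs
  imports "HOL-Analysis.Analysis" "HOL-Library.Function_Algebras" "HOL-Library.Set_Algebras"
begin

section \<open>Pointwise real vector space structure on functions, quotient spaces\<close>

instantiation "fun" :: (type, real_vector) real_vector
begin

definition scaleR_fun :: "real \<Rightarrow> ('a \<Rightarrow> 'b) \<Rightarrow> 'a \<Rightarrow> 'b"
  where "scaleR_fun c f = (\<lambda>x. c *\<^sub>R f x)"

instance
  by standard (auto simp: scaleR_fun_def fun_eq_iff algebra_simps)

end

definition quotient_space :: "'v::real_vector set \<Rightarrow> 'v set \<Rightarrow> 'v set set"
  where "quotient_space Z B = (\<lambda>z. z +o B) ` Z"

text \<open>A subquotient \<open>Z / B\<close> is presented by the pair \<open>(Z, B)\<close>. On cosets of the subspace \<open>B\<close>, the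
  elementwise sum is the addition of the quotient, and \<open>c X + B\<close> is its scalar multiplication
  (adding \<open>B\<close> matters only for \<open>c = 0\<close>).\<close>

definition isomorphic_quotients ::
    "'v::real_vector set \<times> 'v set \<Rightarrow> 'w::real_vector set \<times> 'w set \<Rightarrow> bool"  (infix \<open>\<cong>\<close> 50)
  where "H \<cong> H' \<longleftrightarrow> (case (H, H') of ((Z, B), (Z', B')) \<Rightarrow>
    \<exists>\<phi>. bij_betw \<phi> (quotient_space Z B) (quotient_space Z' B') \<and>
        (\<forall>X \<in> quotient_space Z B. \<forall>Y \<in> quotient_space Z B. \<phi> (X + Y) = \<phi> X + \<phi> Y) \<and>
        (\<forall>c. \<forall>X \<in> quotient_space Z B.
            \<phi> ((*\<^sub>R) c ` X + B) = (*\<^sub>R) c ` \<phi> X + B'))"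


section \<open>Forms and multivector fields on $R^3$\<close>

text \<open>\<open>C_diff k f\<close>: \<open>f\<close> is \<open>k\<close> times continuously differentiable on the whole space.\<close>

primrec C_diff :: "nat \<Rightarrow> (real^3 \<Rightarrow> real) \<Rightarrow> bool"
  where
    "C_diff 0 f \<longleftrightarrow> continuous_on UNIV f"
  | "C_diff (Suc k) f \<longleftrightarrow>
       (\<forall>x. f differentiable (at x)) \<and> (\<forall>v. C_diff k (\<lambda>x. frechet_derivative f (at x) v))"

definition smooth :: "(real^3 \<Rightarrow> real) \<Rightarrow> bool"
  where "smooth f \<longleftrightarrow> (\<forall>k. C_diff k f)"

text \<open>An alternating \<open>k\<close>-linear function takes its \<open>k\<close> arguments as a list; it is set to \<open>0\<close> on
  lists of any other length.\<close>

definition alternating_multilinear :: "nat \<Rightarrow> ((real^3) list \<Rightarrow> real) \<Rightarrow> bool"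
  where "alternating_multilinear k T \<longleftrightarrow>
    (\<forall>us. length us \<noteq> k \<longrightarrow> T us = 0) \<and>
    (\<forall>us i. length us = k \<and> i < k \<longrightarrow> linear (\<lambda>u. T (us[i := u]))) \<and>
    (\<forall>us i j. length us = k \<and> i < j \<and> j < k \<and> us ! i = us ! j \<longrightarrow> T us = 0)"

text \<open>Tangent and cotangent spaces are both identified with \<open>real^3\<close> by means of the coordinate bases
  \<open>\<partial>/\<partial>x\<^sub>i\<close> and \<open>dx\<^sub>i\<close>, each of them corresponding to \<open>axis i 1\<close>. A form is evaluated on lists
  of tangent vectors, a multivector field on lists of covectors; the pairing of a covector and a
  vector becomes the inner product.\<close>

type_synonym form = "real^3 \<Rightarrow> (real^3) list \<Rightarrow> real"
type_synonym multivector = "real^3 \<Rightarrow> (real^3) list \<Rightarrow> real"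

definition smooth_alternating :: "nat \<Rightarrow> (real^3 \<Rightarrow> (real^3) list \<Rightarrow> real) set"
  where "smooth_alternating k =
    {T. (\<forall>x. alternating_multilinear k (T x)) \<and> (\<forall>us. smooth (\<lambda>x. T x us))}"

abbreviation Forms :: "nat \<Rightarrow> form set"
  where "Forms \<equiv> smooth_alternating"

abbreviation Multivectors :: "nat \<Rightarrow> multivector set"
  where "Multivectors \<equiv> smooth_alternating"

text \<open>Contraction of the first \<open>k\<close> slots of \<open>P\<close> with \<open>\<beta>\<close> of degree \<open>k\<close>. Writing \<open>\<beta>\<close> as the sum of
  \<open>\<beta>(e\<^sub>i\<^sub>1,\<dots>,e\<^sub>i\<^sub>k) e\<^sup>i\<^sup>1 \<and> \<dots> \<and> e\<^sup>i\<^sup>k\<close> over increasing indices and extending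
  \<open>i(\<alpha>\<^sub>1 \<and> \<dots> \<and> \<alpha>\<^sub>k)P = P(\<alpha>\<^sub>1,\<dots>,\<alpha>\<^sub>k,\<dots>)\<close> linearly gives the formula below; the sum over all index tuples
  counts each increasing one \<open>k!\<close> times. The same formula serves for \<open>i(P)\<omega>\<close>.\<close>

definition contract ::
    "nat \<Rightarrow> (real^3 \<Rightarrow> (real^3) list \<Rightarrow> real) \<Rightarrow> (real^3 \<Rightarrow> (real^3) list \<Rightarrow> real) \<Rightarrow> real^3 \<Rightarrow> (real^3) list \<Rightarrow> real"
  where "contract k \<beta> P = (\<lambda>x us.
    (\<Sum>es | set es \<subseteq> Basis \<and> length es = k. \<beta> x es * P x (es @ us)) / fact k)"

definition omit :: "nat \<Rightarrow> 'a list \<Rightarrow> 'a list"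
  where "omit i xs = take i xs @ drop (Suc i) xs"

definition ext_deriv :: "form \<Rightarrow> form"
  where "ext_deriv \<omega> = (\<lambda>x us. \<Sum>i<length us.
    (-1) ^ i * frechet_derivative (\<lambda>y. \<omega> y (omit i us)) (at x) (us ! i))"

definition lie_bracket :: "(real^3 \<Rightarrow> real^3) \<Rightarrow> (real^3 \<Rightarrow> real^3) \<Rightarrow> real^3 \<Rightarrow> real^3"
  where "lie_bracket X Y = (\<lambda>x.
    frechet_derivative Y (at x) (X x) - frechet_derivative X (at x) (Y x))"

definition deriv_along :: "(real^3 \<Rightarrow> real^3) \<Rightarrow> (real^3 \<Rightarrow> real) \<Rightarrow> real^3 \<Rightarrow> real"
  where "deriv_along X f = (\<lambda>x. frechet_derivative f (at x) (X x))"

text \<open>The formula \<open>(L\<^sub>X \<beta>)(Y\<^sub>1,\<dots>,Y\<^sub>k) = X(\<beta>(Y\<^sub>1,\<dots>,Y\<^sub>k)) - \<Sum>\<^sub>i \<beta>(Y\<^sub>1,\<dots>,[X,Y\<^sub>i],\<dots>,Y\<^sub>k)\<close>, evaluated at given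
  vectors by extending them to constant vector fields.\<close>

definition lie_deriv :: "(real^3 \<Rightarrow> real^3) \<Rightarrow> form \<Rightarrow> form"
  where "lie_deriv X \<beta> = (\<lambda>x us. deriv_along X (\<lambda>y. \<beta> y us) x
    - (\<Sum>i<length us. \<beta> x (us[i := lie_bracket X (\<lambda>_. us ! i) x])))"

definition vector_field :: "multivector \<Rightarrow> real^3 \<Rightarrow> real^3"
  where "vector_field P = (\<lambda>x. \<Sum>e\<in>Basis. P x [e] *\<^sub>R e)"

definition sharp :: "multivector \<Rightarrow> nat \<Rightarrow> form \<Rightarrow> multivector"
  where "sharp \<Lambda> k \<beta> = contract k \<beta> \<Lambda>"

abbreviation anchor :: "multivector \<Rightarrow> form \<Rightarrow> real^3 \<Rightarrow> real^3"
  where "anchor \<Lambda> \<alpha> \<equiv> vector_field (sharp \<Lambda> 2 \<alpha>)"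


section \<open>Nambu-Poisson cohomology\<close>

text \<open>The function \<open>#\<^sub>3(d\<alpha>)\<close> is the value of a \<open>0\<close>-vector field on the empty list.\<close>

definition leibniz_bracket :: "multivector \<Rightarrow> form \<Rightarrow> form \<Rightarrow> form"
  where "leibniz_bracket \<Lambda> \<alpha> \<beta> = (\<lambda>x us.
    lie_deriv (anchor \<Lambda> \<alpha>) \<beta> x us - sharp \<Lambda> 3 (ext_deriv \<alpha>) x [] * \<beta> x us)"

definition ker_sharp :: "multivector \<Rightarrow> form set"
  where "ker_sharp \<Lambda> = {\<alpha> \<in> Forms 2. sharp \<Lambda> 2 \<alpha> = 0}"

definition form_class :: "multivector \<Rightarrow> form \<Rightarrow> form set"
  where "form_class \<Lambda> \<alpha> = \<alpha> +o ker_sharp \<Lambda>"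

definition form_classes :: "multivector \<Rightarrow> form set set"
  where "form_classes \<Lambda> = quotient_space (Forms 2) (ker_sharp \<Lambda>)"

type_synonym cochain = "form set list \<Rightarrow> real^3 \<Rightarrow> real"

text \<open>A \<open>k\<close>-cochain is extended by \<open>0\<close> outside the \<open>k\<close>-tuples of classes. For \<open>k = 0\<close> only its value on
  the empty list, an arbitrary smooth function, remains.\<close>

definition cochains :: "multivector \<Rightarrow> nat \<Rightarrow> cochain set"
  where "cochains \<Lambda> k = {c.
    (\<forall>As. \<not> (length As = k \<and> set As \<subseteq> form_classes \<Lambda>) \<longrightarrow> c As = 0) \<and>
    (\<forall>As. smooth (c As)) \<and>
    (\<forall>As i \<alpha> \<beta>. length As = k \<and> set As \<subseteq> form_classes \<Lambda> \<and> i < k \<and> \<alpha> \<in> Forms 2 \<and> \<beta> \<in> Forms 2 \<longrightarrow>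
       c (As[i := form_class \<Lambda> (\<alpha> + \<beta>)]) =
         c (As[i := form_class \<Lambda> \<alpha>]) + c (As[i := form_class \<Lambda> \<beta>])) \<and>
    (\<forall>As i f \<alpha>. length As = k \<and> set As \<subseteq> form_classes \<Lambda> \<and> i < k \<and> smooth f \<and> \<alpha> \<in> Forms 2 \<longrightarrow>
       c (As[i := form_class \<Lambda> (\<lambda>x us. f x * \<alpha> x us)]) =
         (\<lambda>x. f x * c (As[i := form_class \<Lambda> \<alpha>]) x)) \<and>
    (\<forall>As i j. length As = k \<and> set As \<subseteq> form_classes \<Lambda> \<and> i < j \<and> j < k \<longrightarrow>
       c (As[i := As ! j, j := As ! i]) = - c As)}"

text \<open>Used only in \<open>NP_coboundary\<close>, whose value does not depend on the representatives chosen.\<close>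

definition representative :: "form set \<Rightarrow> form"
  where "representative A = (SOME \<alpha>. \<alpha> \<in> A)"

text \<open>The sign \<open>(-1)\<^sup>i\<^sup>-\<^sup>1\<close> is written as \<open>(-1) ^ (i + 1)\<close>, to avoid truncated subtraction at \<open>i = 0\<close>.\<close>

definition NP_coboundary :: "multivector \<Rightarrow> nat \<Rightarrow> cochain \<Rightarrow> cochain"
  where "NP_coboundary \<Lambda> k c = (\<lambda>As x.
    if length As = k + 1 \<and> set As \<subseteq> form_classes \<Lambda> then
      (let \<alpha> = (\<lambda>i. representative (As ! i)) in
        (\<Sum>i\<le>k. (-1) ^ i * deriv_along (anchor \<Lambda> (\<alpha> i)) (c (omit i As)) x)
        + (\<Sum>j\<le>k. \<Sum>i<j. (-1) ^ (i + 1) *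
            c (omit i (As[j := form_class \<Lambda> (leibniz_bracket \<Lambda> (\<alpha> i) (\<alpha> j))])) x))
    else 0)"

definition NP_cocycles :: "multivector \<Rightarrow> nat \<Rightarrow> cochain set"
  where "NP_cocycles \<Lambda> k = {c \<in> cochains \<Lambda> k. NP_coboundary \<Lambda> k c = 0}"

definition NP_coboundaries :: "multivector \<Rightarrow> nat \<Rightarrow> cochain set"
  where "NP_coboundaries \<Lambda> k =
    (if k = 0 then {0} else NP_coboundary \<Lambda> (k - 1) ` cochains \<Lambda> (k - 1))"

definition H_NP :: "multivector \<Rightarrow> nat \<Rightarrow> cochain set \<times> cochain set"
  where "H_NP \<Lambda> k = (NP_cocycles \<Lambda> k, NP_coboundaries \<Lambda> k)"


section \<open>Canonical Nambu-Poisson homology\<close>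

text \<open>The common coordinate expression of \<open>dx\<^sub>1 \<and> dx\<^sub>2 \<and> dx\<^sub>3\<close> and of
  \<open>\<partial>/\<partial>x\<^sub>1 \<and> \<partial>/\<partial>x\<^sub>2 \<and> \<partial>/\<partial>x\<^sub>3\<close>, with value \<open>1\<close> on the ordered dual basis.\<close>

definition det3 :: "(real^3) list \<Rightarrow> real"
  where "det3 us = (if length us = 3 then det (vector us :: real^3^3) else 0)"

definition volume_form :: form
  where "volume_form = (\<lambda>x. det3)"

definition flat :: "nat \<Rightarrow> multivector \<Rightarrow> form"
  where "flat k P = contract k P volume_form"

text \<open>On \<open>k\<close>-vector fields with \<open>k > 0\<close>, the map \<open>flat\<inverse> \<circ> d \<circ> flat\<close> passes through forms of degree
  \<open>3 - k\<close> and \<open>4 - k\<close>. It vanishes on functions.\<close>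

definition NP_boundary :: "nat \<Rightarrow> multivector \<Rightarrow> multivector"
  where "NP_boundary k P = (if k = 0 then 0
    else the_inv_into (Multivectors (k - 1)) (flat (k - 1)) (ext_deriv (flat k P)))"

definition tangent_multivectors :: "multivector \<Rightarrow> nat \<Rightarrow> multivector set"
  where "tangent_multivectors \<Lambda> k = (if k = 0 then Multivectors 0
    else {P \<in> Multivectors k. \<forall>\<alpha> \<in> Forms 1. sharp \<Lambda> 1 \<alpha> = 0 \<longrightarrow> contract 1 \<alpha> P = 0})"

definition can_cycles :: "multivector \<Rightarrow> nat \<Rightarrow> multivector set"
  where "can_cycles \<Lambda> k = {P \<in> tangent_multivectors \<Lambda> k. NP_boundary k P = 0}"

text \<open>For \<open>k = 3\<close> this is zero, since \<open>Multivectors 4 = {0}\<close>.\<close>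

definition can_boundaries :: "multivector \<Rightarrow> nat \<Rightarrow> multivector set"
  where "can_boundaries \<Lambda> k = NP_boundary (k + 1) ` tangent_multivectors \<Lambda> (k + 1)"

definition H_canNP :: "multivector \<Rightarrow> nat \<Rightarrow> multivector set \<times> multivector set"
  where "H_canNP \<Lambda> k = (can_cycles \<Lambda> k, can_boundaries \<Lambda> k)"


definition Lambda_sing :: multivector
  where "Lambda_sing = (\<lambda>x us. ((x $ 1)\<^sup>2 + (x $ 2)\<^sup>2 + (x $ 3)\<^sup>2) * det3 us)"

end

theory Submission
  imports Defs
begin

text \<open>Write \<open>r\<^sup>2\<close> for the coefficient \<open>x \<bullet> x\<close> of \<open>\<Lambda>\<close>. The two spaces differ because the homology is zero
  and the cohomology is not.

  Homology. Since \<open>r\<^sup>2\<close> vanishes only at the origin, \<open>#\<^sub>1\<close> is injective on smooth forms, so every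
  multivector field is tangent. Hence the canonical complex is the de Rham complex of \<open>R\<^sup>3\<close>, seen
  through \<open>flat\<close>, and its homology in degree 2 is the first de Rham cohomology, which is zero
  by the Poincare lemma (\<open>Poincare_1_forms\<close>, \<open>can_cycles_2_subset\<close>, \<open>H_canNP_2_trivial\<close>).

  Cohomology. Every 2-form is \<open>i(Y)\<nu>\<close> for a vector field \<open>Y\<close>, and \<open>#\<^sub>2\<close> sends it to \<open>r\<^sup>2 Y\<close>; this too is
  injective. So 1-cochains amount to 1-forms. A 1-form \<open>c\<close> is a cocycle iff \<open>r\<^sup>2 dc = d(r\<^sup>2) \<and> c\<close>, that is,
  \<open>c / r\<^sup>2\<close> is closed off the origin, and it is a coboundary iff \<open>c = r\<^sup>2 dh\<close> with \<open>h\<close> smooth on the whole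
  space. The form \<open>d(r\<^sup>2)\<close> is a cocycle, with primitive \<open>ln r\<^sup>2\<close> of \<open>d(r\<^sup>2) / r\<^sup>2\<close>, but not a coboundary:
  along the first axis \<open>2 t = t\<^sup>2 \<partial>h/\<partial>x\<^sub>1\<close> would make \<open>\<partial>h/\<partial>x\<^sub>1\<close> unbounded near \<open>0\<close>
  (\<open>radial_cochain_cocycle\<close>, \<open>radial_cochain_not_coboundary\<close>).\<close>


section \<open>Smooth functions and vector fields\<close>

lemma C_diff_SucD: "C_diff (Suc k) f \<Longrightarrow> C_diff k f"
proof (induction k arbitrary: f)
  case 0
  then show ?case
    by (auto intro!: differentiable_imp_continuous_on simp: differentiable_on_def)
next
  case (Suc k)
  then show ?case by simp
qed

lemma C_diff_const: "C_diff k (\<lambda>x. c)"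
  by (induction k arbitrary: c) simp_all

lemma C_diff_linear:
  assumes "bounded_linear f"
  shows "C_diff k f"
proof (cases k)
  case 0
  then show ?thesis
    using linear_continuous_on[OF assms] by simp
next
  case (Suc m)
  have "frechet_derivative f (at x) = f" for x
    using frechet_derivative_at[OF bounded_linear_imp_has_derivative[OF assms]] by metis
  then show ?thesis
    using Suc bounded_linear_imp_differentiable[OF assms] by (simp add: C_diff_const)
qed

lemma C_diff_add: "C_diff k f \<Longrightarrow> C_diff k g \<Longrightarrow> C_diff k (\<lambda>x. f x + g x)"
proof (induction k arbitrary: f g)
  case 0
  then show ?case by (simp add: continuous_on_add)
next
  case (Suc k)
  have "frechet_derivative (\<lambda>x. f x + g x) (at x) v
      = frechet_derivative f (at x) v + frechet_derivative g (at x) v" for x v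
  proof -
    have "(f has_derivative frechet_derivative f (at x)) (at x)"
      "(g has_derivative frechet_derivative g (at x)) (at x)"
      using Suc.prems by (simp_all flip: frechet_derivative_works)
    from frechet_derivative_at[OF has_derivative_add[OF this]] show ?thesis
      by (rule fun_cong[OF sym])
  qed
  then show ?case using Suc by simp
qed

lemma C_diff_mult: "C_diff k f \<Longrightarrow> C_diff k g \<Longrightarrow> C_diff k (\<lambda>x. f x * g x)"
proof (induction k arbitrary: f g)
  case 0
  then show ?case by (simp add: continuous_on_mult)
next
  case (Suc k)
  have f: "f differentiable at x" and g: "g differentiable at x" for x
    using Suc.prems by simp_all
  have D: "frechet_derivative (\<lambda>x. f x * g x) (at x) v
      = f x * frechet_derivative g (at x) v + frechet_derivative f (at x) v * g x" for x v
    using frechet_derivative_at[OF has_derivative_mult[OF f[of x, unfolded frechet_derivative_works]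
          g[of x, unfolded frechet_derivative_works]]] by (rule fun_cong[OF sym])
  have "C_diff k (\<lambda>x. f x * frechet_derivative g (at x) v + frechet_derivative f (at x) v * g x)"
    for v
    using Suc.prems by (intro C_diff_add Suc.IH C_diff_SucD[of k f] C_diff_SucD[of k g]) simp_all
  then show ?case
    using f g by (simp add: D differentiable_mult)
qed

lemma smooth_const [simp]: "smooth (\<lambda>x. c)"
  by (simp add: smooth_def C_diff_const)

lemma smooth_zero [simp]: "smooth 0"
  using smooth_const[of 0] by (simp add: zero_fun_def)

lemma smooth_linear: "bounded_linear f \<Longrightarrow> smooth f"
  by (simp add: smooth_def C_diff_linear)

lemma smooth_add: "smooth f \<Longrightarrow> smooth g \<Longrightarrow> smooth (\<lambda>x. f x + g x)"
  by (simp add: smooth_def C_diff_add)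

lemma smooth_mult: "smooth f \<Longrightarrow> smooth g \<Longrightarrow> smooth (\<lambda>x. f x * g x)"
  by (simp add: smooth_def C_diff_mult)

lemma smooth_minus: "smooth f \<Longrightarrow> smooth (\<lambda>x. - f x)"
  using smooth_mult[of "\<lambda>x. -1" f] by simp

lemma smooth_diff: "smooth f \<Longrightarrow> smooth g \<Longrightarrow> smooth (\<lambda>x. f x - g x)"
  using smooth_add[OF _ smooth_minus[of g]] by simp

lemma smooth_sum: "(\<And>i. i \<in> I \<Longrightarrow> smooth (f i)) \<Longrightarrow> smooth (\<lambda>x. \<Sum>i\<in>I. f i x)"
  by (induction I rule: infinite_finite_induct) (simp_all add: smooth_add)

lemma smooth_continuous: "smooth f \<Longrightarrow> continuous_on UNIV f"
  unfolding smooth_def by (metis C_diff.simps(1))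

lemma smooth_differentiable: "smooth f \<Longrightarrow> f differentiable (at x)"
  unfolding smooth_def by (metis C_diff.simps(2))

lemma smooth_frechet_derivative: "smooth f \<Longrightarrow> smooth (\<lambda>x. frechet_derivative f (at x) v)"
  unfolding smooth_def by (metis C_diff.simps(2))

lemma smoothI_derivative:
  assumes "\<And>x. f differentiable (at x)" "\<And>v. smooth (\<lambda>x. frechet_derivative f (at x) v)"
  shows "smooth f"
  unfolding smooth_def
proof
  fix k
  show "C_diff k f"
  proof (cases k)
    case 0
    then show ?thesis
      using assms(1) by (auto intro!: differentiable_imp_continuous_on simp: differentiable_on_def)
  next
    case (Suc m)
    then show ?thesis
      using assms by (simp add: smooth_def)
  qed
qed

text \<open>Vector fields, as maps into \<open>R\<^sup>3\<close>, are smooth when their components are.\<close>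

definition smooth_field :: "(real^3 \<Rightarrow> real^3) \<Rightarrow> bool"
  where "smooth_field Y \<longleftrightarrow> (\<forall>i. smooth (\<lambda>x. Y x $ i))"

lemma smooth_field_id: "smooth_field (\<lambda>x. x)"
  by (simp add: smooth_field_def smooth_linear bounded_linear_vec_nth)

lemma smooth_field_const [simp]: "smooth_field (\<lambda>x. v)"
  by (simp add: smooth_field_def)

lemma smooth_field_add: "smooth_field Y \<Longrightarrow> smooth_field Z \<Longrightarrow> smooth_field (\<lambda>x. Y x + Z x)"
  by (simp add: smooth_field_def smooth_add)

lemma smooth_field_diff: "smooth_field Y \<Longrightarrow> smooth_field Z \<Longrightarrow> smooth_field (\<lambda>x. Y x - Z x)"
  by (simp add: smooth_field_def smooth_diff)

lemma smooth_field_scaleR: "smooth f \<Longrightarrow> smooth_field Y \<Longrightarrow> smooth_field (\<lambda>x. f x *\<^sub>R Y x)"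
  by (simp add: smooth_field_def smooth_mult)

lemma smooth_inner: "smooth_field Y \<Longrightarrow> smooth_field Z \<Longrightarrow> smooth (\<lambda>x. Y x \<bullet> Z x)"
  by (simp add: smooth_field_def inner_vec_def smooth_sum smooth_mult)

lemma smooth_field_has_derivative:
  assumes "smooth_field Y"
  shows "(Y has_derivative frechet_derivative Y (at x)) (at x)"
proof -
  have "Y differentiable (at x)"
  proof (subst differentiable_componentwise_within, intro ballI)
    fix i :: "real^3" assume "i \<in> Basis"
    then obtain k where "i = axis k 1" by (auto simp: Basis_vec_def)
    then show "(\<lambda>x. Y x \<bullet> i) differentiable at x"
      using assms smooth_differentiable by (auto simp: inner_axis smooth_field_def)
  qed
  then show ?thesis by (simp flip: frechet_derivative_works)
qed

lemma frechet_derivative_inner_left: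
  assumes "smooth_field Y"
  shows "frechet_derivative (\<lambda>y. Y y \<bullet> v) (at x) = (\<lambda>u. frechet_derivative Y (at x) u \<bullet> v)"
  by (rule frechet_derivative_at[symmetric])
    (intro has_derivative_inner_left smooth_field_has_derivative assms)

lemma smooth_inner_const: "smooth_field Y \<Longrightarrow> smooth (\<lambda>x. Y x \<bullet> v)"
  by (simp add: smooth_inner)

lemma smooth_field_derivative_const:
  assumes "smooth_field Y"
  shows "smooth_field (\<lambda>x. frechet_derivative Y (at x) v)"
proof -
  have "frechet_derivative Y (at x) v $ i = frechet_derivative (\<lambda>y. Y y $ i) (at x) v" for x i
    using frechet_derivative_inner_left[OF assms, of "axis i 1" x] by (simp add: inner_axis)
  then show ?thesis
    using assms by (simp add: smooth_field_def smooth_frechet_derivative)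
qed

lemma linear_expand_3:
  fixes L :: "real^3 \<Rightarrow> 'a::real_vector"
  assumes "linear L"
  shows "L v = v$1 *\<^sub>R L (axis 1 1) + v$2 *\<^sub>R L (axis 2 1) + v$3 *\<^sub>R L (axis 3 1)"
proof -
  have "v = v$1 *\<^sub>R axis 1 1 + v$2 *\<^sub>R axis 2 1 + v$3 *\<^sub>R axis 3 1"
    by (simp add: vec_eq_iff axis_def forall_3)
  then show ?thesis
    by (metis linear_add[OF assms] linear_scale[OF assms])
qed

lemma linear_frechet_derivative_field:
  "smooth_field Y \<Longrightarrow> linear (frechet_derivative Y (at x))"
  using smooth_field_has_derivative has_derivative_linear by blast

lemma smooth_field_derivative:
  assumes "smooth_field Y" "smooth_field X"
  shows "smooth_field (\<lambda>x. frechet_derivative Y (at x) (X x))"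
proof -
  have "frechet_derivative Y (at x) (X x) = X x $ 1 *\<^sub>R frechet_derivative Y (at x) (axis 1 1)
      + X x $ 2 *\<^sub>R frechet_derivative Y (at x) (axis 2 1)
      + X x $ 3 *\<^sub>R frechet_derivative Y (at x) (axis 3 1)" for x
    by (rule linear_expand_3[OF linear_frechet_derivative_field[OF assms(1)]])
  moreover have "smooth (\<lambda>x. X x $ i)" for i
    using assms(2) by (simp add: smooth_field_def)
  ultimately show ?thesis
    using assms(1)
    by (simp add: smooth_field_add smooth_field_scaleR smooth_field_derivative_const)
qed

lemma smooth_field_continuous: "smooth_field Y \<Longrightarrow> continuous_on UNIV Y"
  by (rule continuous_at_imp_continuous_on)
    (metis has_derivative_continuous smooth_field_has_derivative)


section \<open>Closed 1-forms on \<open>R^3\<close> are exact\<close>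

text \<open>A field \<open>Y\<close> with symmetric derivative, regarded as a closed 1-form, is the gradient of
  \<open>h x = \<integral>\<^sub>0\<^sup>1 Y(t x) \<bullet> x dt\<close>. Only differentiability of \<open>h\<close> requires work: smoothness is inherited from
  its derivative \<open>Y\<close>.\<close>

lemma Poincare_1_forms:
  assumes Y: "smooth_field Y"
    and closed: "\<And>x u v. frechet_derivative Y (at x) u \<bullet> v = frechet_derivative Y (at x) v \<bullet> u"
  obtains h where "smooth h" "\<And>x. (h has_derivative (\<lambda>v. Y x \<bullet> v)) (at x)"
proof -
  define DY where "DY x = frechet_derivative Y (at x)" for x
  have DY: "(Y has_derivative DY x) (at x)" for x
    unfolding DY_def by (rule smooth_field_has_derivative[OF Y])
  have lin: "linear (DY x)" for x
    using DY has_derivative_linear by blast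
  have contY: "continuous_on UNIV Y"
    by (rule smooth_field_continuous[OF Y])
  have contDY: "continuous_on UNIV (\<lambda>x. DY x v)" for v
    unfolding DY_def by (intro smooth_field_continuous smooth_field_derivative_const Y)
  \<comment> \<open>\<open>G x t\<close> is both the \<open>t\<close>-derivative of \<open>t Y(t x)\<close> and, by closedness, the gradient in \<open>x\<close> of
    \<open>Y(t x) \<bullet> x\<close>.\<close>
  define G where "G x t = t *\<^sub>R DY (t *\<^sub>R x) x + Y (t *\<^sub>R x)" for x t
  define h where "h x = integral (cbox 0 1) (\<lambda>t. Y (t *\<^sub>R x) \<bullet> x)" for x
  have contG: "continuous_on (UNIV \<times> cbox 0 1) (\<lambda>(x, t). G x t)"
  proof -
    have "DY (t *\<^sub>R x) x = x $ 1 *\<^sub>R DY (t *\<^sub>R x) (axis 1 1) + x $ 2 *\<^sub>R DY (t *\<^sub>R x) (axis 2 1)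
      + x $ 3 *\<^sub>R DY (t *\<^sub>R x) (axis 3 1)" for x t
      by (rule linear_expand_3[OF lin])
    then show ?thesis
      unfolding G_def split_beta
      by (auto intro!: continuous_intros continuous_on_compose2[OF contY]
          continuous_on_compose2[OF contDY])
  qed
  have Dx: "((\<lambda>x. Y (t *\<^sub>R x) \<bullet> x) has_derivative blinfun_apply (blinfun_inner_left (G x t)))
      (at x within UNIV)" for x t
  proof -
    have "((\<lambda>x. Y (t *\<^sub>R x)) has_derivative (\<lambda>v. DY (t *\<^sub>R x) (t *\<^sub>R v))) (at x)"
      by (rule has_derivative_compose[OF _ DY, where f = "\<lambda>x. t *\<^sub>R x"])
        (auto intro!: derivative_eq_intros)
    then have "((\<lambda>x. Y (t *\<^sub>R x) \<bullet> x) has_derivative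
        (\<lambda>v. Y (t *\<^sub>R x) \<bullet> v + DY (t *\<^sub>R x) (t *\<^sub>R v) \<bullet> x)) (at x)"
      by (auto intro!: derivative_eq_intros)
    moreover have "(\<lambda>v. Y (t *\<^sub>R x) \<bullet> v + DY (t *\<^sub>R x) (t *\<^sub>R v) \<bullet> x)
        = blinfun_apply (blinfun_inner_left (G x t))"
      using closed
      by (auto simp: G_def DY_def[symmetric] linear_scale[OF lin] inner_simps inner_commute)
    ultimately show ?thesis by simp
  qed
  have int: "(\<lambda>t. Y (t *\<^sub>R x) \<bullet> x) integrable_on cbox 0 1" for x
    by (intro integrable_continuous continuous_intros continuous_on_compose2[OF contY]) auto
  have contL: "continuous_on (UNIV \<times> cbox 0 1) (\<lambda>(x, t). blinfun_inner_left (G x t))"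
    using bounded_linear.continuous_on[OF bounded_linear_blinfun_inner_left contG]
    by (simp add: split_beta)
  have Gx: "(G x has_integral Y x) (cbox 0 1)" for x
  proof -
    have "((\<lambda>t. t *\<^sub>R Y (t *\<^sub>R x)) has_vector_derivative G x t) (at t within {0..1})" for t
    proof -
      have "((\<lambda>t. Y (t *\<^sub>R x)) has_derivative (\<lambda>s. DY (t *\<^sub>R x) (s *\<^sub>R x))) (at t within {0..1})"
        by (rule has_derivative_compose[OF _ DY, where f = "\<lambda>t. t *\<^sub>R x"])
          (auto intro!: derivative_eq_intros)
      then have "((\<lambda>t. t *\<^sub>R Y (t *\<^sub>R x)) has_derivative
          (\<lambda>s. t *\<^sub>R DY (t *\<^sub>R x) (s *\<^sub>R x) + s *\<^sub>R Y (t *\<^sub>R x))) (at t within {0..1})"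
        by (auto intro!: derivative_eq_intros)
      then show ?thesis
        by (simp add: has_vector_derivative_def G_def linear_scale[OF lin] algebra_simps)
    qed
    then show ?thesis
      using fundamental_theorem_of_calculus[of 0 1 "\<lambda>t. t *\<^sub>R Y (t *\<^sub>R x)" "G x"] by simp
  qed
  have "(h has_derivative blinfun_apply (integral (cbox 0 1) (\<lambda>t. blinfun_inner_left (G x t))))
      (at x)" for x
    unfolding h_def using leibniz_rule[OF Dx int contL UNIV_I convex_UNIV, of x] by simp
  moreover have "integral (cbox 0 1) (\<lambda>t. blinfun_inner_left (G x t)) = blinfun_inner_left (Y x)"
    for x
    using has_integral_linear[OF Gx bounded_linear_blinfun_inner_left]
    by (simp add: integral_unique o_def)
  moreover have "blinfun_apply (blinfun_inner_left (Y x)) = (\<lambda>v. Y x \<bullet> v)" for x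
    by (auto simp: inner_commute)
  ultimately have Dh: "(h has_derivative (\<lambda>v. Y x \<bullet> v)) (at x)" for x
    by (simp only:)
  have "frechet_derivative h (at x) = (\<lambda>v. Y x \<bullet> v)" for x
    using frechet_derivative_at[OF Dh] by simp
  moreover have "h differentiable (at x)" for x
    by (rule differentiableI[OF Dh])
  ultimately have "smooth h"
    using smooth_inner_const[OF Y] by (simp add: smoothI_derivative inner_commute)
  then show thesis using Dh by (rule that)
qed


section \<open>Exterior algebra in dimension three\<close>

abbreviation e1 :: "real^3" where "e1 \<equiv> axis 1 1"
abbreviation e2 :: "real^3" where "e2 \<equiv> axis 2 1"
abbreviation e3 :: "real^3" where "e3 \<equiv> axis 3 1"

lemma axis_3_simps [simp]:
  "e1 $ 1 = 1" "e1 $ 2 = 0" "e1 $ 3 = 0"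
  "e2 $ 1 = 0" "e2 $ 2 = 1" "e2 $ 3 = 0"
  "e3 $ 1 = 0" "e3 $ 2 = 0" "e3 $ 3 = 1"
  by (simp_all add: axis_def)

lemma sum_Basis_3:
  fixes F :: "real^3 \<Rightarrow> 'a::comm_monoid_add"
  shows "(\<Sum>e\<in>Basis. F e) = F e1 + F e2 + F e3"
proof -
  have B: "(Basis :: (real^3) set) = range (\<lambda>i. axis i 1)"
    by (auto simp: Basis_vec_def)
  have "inj (\<lambda>i::3. axis i (1::real))"
    by (simp add: inj_on_def axis_eq_axis)
  then show ?thesis
    unfolding B by (simp add: sum.reindex sum_3)
qed

lemma sum_tuples_0: "(\<Sum>es | set es \<subseteq> B \<and> length es = 0. F es) = F []"
proof -
  have "{es. set es \<subseteq> B \<and> length es = 0} = {[]}" by auto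
  then show ?thesis by simp
qed

lemma sum_tuples_Suc:
  assumes "finite B"
  shows "(\<Sum>es | set es \<subseteq> B \<and> length es = Suc k. F es)
    = (\<Sum>e\<in>B. \<Sum>es | set es \<subseteq> B \<and> length es = k. F (e # es))"
proof -
  let ?T = "\<lambda>k. {es. set es \<subseteq> B \<and> length es = k}"
  have "?T (Suc k) = (\<lambda>(e, es). e # es) ` (B \<times> ?T k)"
    by (auto simp: length_Suc_conv image_iff)
  moreover have "inj_on (\<lambda>(e, es). e # es) (B \<times> ?T k)"
    by (auto simp: inj_on_def)
  ultimately have "sum F (?T (Suc k)) = (\<Sum>(e, es)\<in>B \<times> ?T k. F (e # es))"
    by (simp add: sum.reindex o_def case_prod_unfold)
  also have "\<dots> = (\<Sum>e\<in>B. \<Sum>es\<in>?T k. F (e # es))"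
    by (simp add: sum.cartesian_product)
  finally show ?thesis .
qed

lemma contract_1: "contract (Suc 0) \<beta> P x us = (\<Sum>e\<in>Basis. \<beta> x [e] * P x (e # us))"
  by (simp add: contract_def sum_tuples_Suc sum_tuples_0[simplified])

lemma contract_2: "contract 2 \<beta> P x us = (\<Sum>e\<in>Basis. \<Sum>e'\<in>Basis. \<beta> x [e, e'] * P x (e # e' # us)) / 2"
  by (simp add: contract_def numeral_2_eq_2 sum_tuples_Suc sum_tuples_0[simplified])

lemma contract_3: "contract 3 \<beta> P x us
    = (\<Sum>e\<in>Basis. \<Sum>e'\<in>Basis. \<Sum>e''\<in>Basis. \<beta> x [e, e', e''] * P x (e # e' # e'' # us)) / 6"
  by (simp add: contract_def numeral_3_eq_3 sum_tuples_Suc sum_tuples_0[simplified] fact_numeral)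

lemma det3_length: "length us \<noteq> 3 \<Longrightarrow> det3 us = 0"
  by (simp add: det3_def)

lemma det3_triple: "det3 [u, v, w] = u \<bullet> cross3 v w"
  by (simp add: det3_def dot_cross_det)

lemma inner_3: "u \<bullet> v = u$1 * v$1 + u$2 * v$2 + u$3 * v$3" for u v :: "real^3"
  by (simp add: inner_vec_def sum_3)

lemma cross3_nth: 
  "cross3 u v $ 1 = u$2 * v$3 - u$3 * v$2"
  "cross3 u v $ 2 = u$3 * v$1 - u$1 * v$3"
  "cross3 u v $ 3 = u$1 * v$2 - u$2 * v$1"
  by (simp_all add: cross3_def)

lemmas coords_3 = inner_3 cross3_nth

text \<open>Functions and vector fields as alternating forms of degree 0, 1 and 2. The degree 2 form
  \<open>(u, v) \<mapsto> Y \<bullet> (u \<times> v)\<close> is the contraction \<open>i(Y)\<nu>\<close> of the volume form. The same expressions serve as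
  multivector fields, since tangent and cotangent spaces are identified.\<close>

definition alt0 :: "(real^3 \<Rightarrow> real) \<Rightarrow> form"
  where "alt0 h = (\<lambda>x us. if us = [] then h x else 0)"

definition alt1 :: "(real^3 \<Rightarrow> real^3) \<Rightarrow> form"
  where "alt1 Y = (\<lambda>x us. if length us = 1 then Y x \<bullet> us ! 0 else 0)"

definition alt2 :: "(real^3 \<Rightarrow> real^3) \<Rightarrow> form"
  where "alt2 Y = (\<lambda>x us. if length us = 2 then Y x \<bullet> cross3 (us ! 0) (us ! 1) else 0)"

text \<open>The vector field \<open>Y\<close> for which a 2-form is \<open>i(Y)\<nu>\<close>, read off from its coefficients.\<close>

definition hodge :: "form \<Rightarrow> real^3 \<Rightarrow> real^3"
  where "hodge \<alpha> = (\<lambda>x. vector [\<alpha> x [e2, e3], \<alpha> x [e3, e1], \<alpha> x [e1, e2]])"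

lemma length_2_conv: "length us = 2 \<longleftrightarrow> (\<exists>u v. us = [u, v])"
  by (auto simp: numeral_2_eq_2 length_Suc_conv)

lemma length_3_conv: "length us = 3 \<longleftrightarrow> (\<exists>u v w. us = [u, v, w])"
  by (auto simp: numeral_3_eq_3 length_Suc_conv)

lemma alt1_single [simp]: "alt1 Y x [u] = Y x \<bullet> u"
  by (simp add: alt1_def)

lemma alt2_pair [simp]: "alt2 Y x [u, v] = Y x \<bullet> cross3 u v"
  by (simp add: alt2_def)

lemma hodge_alt2 [simp]: "hodge (alt2 Y) = Y"
  by (simp add: hodge_def fun_eq_iff vec_eq_iff forall_3 coords_3)

lemma alt2_inject: "alt2 Y = alt2 Z \<longleftrightarrow> Y = Z"
  by (metis hodge_alt2)

lemma alt1_inject: "alt1 Y = alt1 Z \<longleftrightarrow> Y = Z"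
  by (metis alt1_single ext vector_eq_rdot)

lemma alternating_pair:
  assumes "alternating_multilinear 2 T"
  shows "T [u, v] = vector [T [e2, e3], T [e3, e1], T [e1, e2]] \<bullet> cross3 u v"
proof -
  have lin: "linear (\<lambda>u. T ([a, b][i := u]))" if "i < 2" for a b i
    using assms that unfolding alternating_multilinear_def by (metis length_2_conv)
  have L: "linear (\<lambda>u. T [u, b])" and R: "linear (\<lambda>v. T [a, v])" for a b
    using lin[of 0 undefined b] lin[of 1 a undefined] by simp_all
  have "\<forall>us i j. length us = 2 \<and> i < j \<and> j < 2 \<and> us ! i = us ! j \<longrightarrow> T us = 0"
    using assms unfolding alternating_multilinear_def by blast
  from this[rule_format, of "[a, a]" 0 1 for a] have alt: "T [a, a] = 0" for a
    by simp
  have skew: "T [b, a] = - T [a, b]" for a b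
    using alt[of "a + b"] linear_add[OF L[of "a + b"], of a b] linear_add[OF R, of _ a b]
      alt[of a] alt[of b] by simp
  have "T [u, v] = u$1 * T [e1, v] + u$2 * T [e2, v] + u$3 * T [e3, v]"
    using linear_expand_3[OF L[of v], of u] by simp
  moreover have "T [a, v] = v$1 * T [a, e1] + v$2 * T [a, e2] + v$3 * T [a, e3]" for a
    using linear_expand_3[OF R[of a], of v] by simp
  ultimately show ?thesis
    using skew[of e1 e2] skew[of e1 e3] skew[of e2 e3]
    by (simp add: coords_3 alt algebra_simps)
qed

lemma alt2_in_Forms:
  assumes "smooth_field Y"
  shows "alt2 Y \<in> Forms 2"
  unfolding smooth_alternating_def alternating_multilinear_def
proof (intro CollectI conjI allI impI)
  fix x and us :: "(real^3) list" and i :: nat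
  assume "length us = 2 \<and> i < 2"
  moreover from this have "i = 0 \<or> i = 1" by auto
  ultimately obtain u v where "us = [u, v]" "i = 0 \<or> i = 1"
    using length_2_conv[THEN iffD1, of us] by blast
  then show "linear (\<lambda>u. alt2 Y x (us[i := u]))"
    by (auto simp: coords_3 algebra_simps intro!: linearI)
next
  fix x and us :: "(real^3) list" and i j :: nat
  assume "length us = 2 \<and> i < j \<and> j < 2 \<and> us ! i = us ! j"
  then have "length us = 2" "i = 0" "j = 1" "us ! i = us ! j"
    by auto
  then show "alt2 Y x us = 0"
    by (auto simp: length_2_conv)
next
  fix us :: "(real^3) list"
  show "smooth (\<lambda>x. alt2 Y x us)"
    using smooth_inner_const[OF assms] by (cases "length us = 2") (simp_all add: alt2_def)
qed (simp add: alt2_def)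

lemma Forms_2E:
  assumes "\<alpha> \<in> Forms 2"
  obtains Y where "smooth_field Y" "\<alpha> = alt2 Y"
proof
  have alt: "alternating_multilinear 2 (\<alpha> x)" and smooth: "smooth (\<lambda>x. \<alpha> x us)" for x us
    using assms by (simp_all add: smooth_alternating_def)
  show "smooth_field (hodge \<alpha>)"
    using smooth by (simp add: smooth_field_def forall_3 hodge_def)
  show "\<alpha> = alt2 (hodge \<alpha>)"
  proof (intro ext)
    fix x us
    show "\<alpha> x us = alt2 (hodge \<alpha>) x us"
    proof (cases "length us = 2")
      case True
      then obtain u v where "us = [u, v]" using length_2_conv[THEN iffD1, of us] by blast
      then show ?thesis
        using alternating_pair[OF alt, of x u v] by (simp add: hodge_def)
    next
      case False
      then show ?thesis
        using alt[of x] by (simp add: alternating_multilinear_def alt2_def)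
    qed
  qed
qed

lemma alt1_in_Forms:
  assumes "smooth_field Y"
  shows "alt1 Y \<in> Forms 1"
  unfolding smooth_alternating_def alternating_multilinear_def
proof (intro CollectI conjI allI impI)
  fix x and us :: "(real^3) list" and i :: nat
  assume "length us = 1 \<and> i < 1"
  then obtain u where "us = [u]" "i = 0"
    by (auto simp: length_Suc_conv)
  then show "linear (\<lambda>u. alt1 Y x (us[i := u]))"
    by (auto simp: inner_simps intro!: linearI)
next
  fix us :: "(real^3) list"
  show "smooth (\<lambda>x. alt1 Y x us)"
    using smooth_inner_const[OF assms] by (cases "length us = 1") (simp_all add: alt1_def)
qed (simp_all add: alt1_def)

lemma Forms_1E:
  assumes "\<alpha> \<in> Forms 1"
  obtains Y where "smooth_field Y" "\<alpha> = alt1 Y"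
proof
  let ?Y = "\<lambda>x. vector [\<alpha> x [e1], \<alpha> x [e2], \<alpha> x [e3]] :: real^3"
  have alt: "alternating_multilinear 1 (\<alpha> x)" and smooth: "smooth (\<lambda>x. \<alpha> x us)" for x us
    using assms by (simp_all add: smooth_alternating_def)
  show "smooth_field ?Y"
    using smooth by (simp add: smooth_field_def forall_3)
  show "\<alpha> = alt1 ?Y"
  proof (intro ext)
    fix x us
    show "\<alpha> x us = alt1 ?Y x us"
    proof (cases "length us = 1")
      case True
      then obtain u where us: "us = [u]" by (auto simp: length_Suc_conv)
      have "linear (\<lambda>u. \<alpha> x (us[0 := u]))"
        using alt[of x] True unfolding alternating_multilinear_def by simp
      then have "linear (\<lambda>u. \<alpha> x [u])"
        by (simp add: us)
      from linear_expand_3[OF this, of u] show ?thesis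
        by (simp add: us inner_3 algebra_simps)
    next
      case False
      then show ?thesis
        using alt[of x] by (simp add: alternating_multilinear_def alt1_def)
    qed
  qed
qed

lemma det3_in_Forms:
  assumes "smooth h"
  shows "(\<lambda>x us. h x * det3 us) \<in> Forms 3"
  unfolding smooth_alternating_def alternating_multilinear_def
proof (intro CollectI conjI allI impI)
  fix x and us :: "(real^3) list" and i :: nat
  assume "length us = 3 \<and> i < 3"
  moreover from this have "i = 0 \<or> i = 1 \<or> i = 2" by auto
  ultimately obtain u v w where "us = [u, v, w]" "i = 0 \<or> i = 1 \<or> i = 2"
    using length_3_conv[THEN iffD1, of us] by blast
  then show "linear (\<lambda>u. h x * det3 (us[i := u]))"
    by (auto simp: det3_triple numeral_2_eq_2 coords_3 algebra_simps intro!: linearI)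
next
  fix x and us :: "(real^3) list" and i j :: nat
  assume "length us = 3 \<and> i < j \<and> j < 3 \<and> us ! i = us ! j"
  then have "length us = 3" "(i = 0 \<and> (j = 1 \<or> j = 2)) \<or> (i = 1 \<and> j = 2)"
      "us ! i = us ! j"
    by auto
  then show "h x * det3 us = 0"
    by (auto simp: length_3_conv det3_triple numeral_2_eq_2 dot_cross_self)
next
  fix us :: "(real^3) list"
  show "smooth (\<lambda>x. h x * det3 us)"
    using assms by (simp add: smooth_mult)
qed (simp add: det3_length)


section \<open>Duality between forms and multivector fields\<close>

lemma flat_1_alt1: "flat 1 (alt1 Y) = alt2 Y"
proof (intro ext)
  fix x and us :: "(real^3) list"
  show "flat 1 (alt1 Y) x us = alt2 Y x us"
  proof (cases "length us = 2")
    case True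
    then obtain u v where "us = [u, v]" using length_2_conv[THEN iffD1, of us] by blast
    then show ?thesis
      by (simp add: flat_def volume_form_def contract_1 sum_Basis_3 det3_triple coords_3)
  next
    case False
    then show ?thesis
      by (simp add: flat_def volume_form_def contract_1 sum_Basis_3 det3_length alt2_def)
  qed
qed

lemma flat_2_alt2: "flat 2 (alt2 Y) = alt1 Y"
proof (intro ext)
  fix x and us :: "(real^3) list"
  show "flat 2 (alt2 Y) x us = alt1 Y x us"
  proof (cases "length us = 1")
    case True
    then obtain u where "us = [u]" by (auto simp: length_Suc_conv)
    then show ?thesis
      by (simp add: flat_def volume_form_def contract_2 sum_Basis_3 det3_triple coords_3)
  next
    case False
    then show ?thesis
      by (simp add: flat_def volume_form_def contract_2 sum_Basis_3 det3_length alt1_def)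
  qed
qed

text \<open>The coefficient of a trivector field is obtained as the value of its contraction with \<open>\<nu>\<close> on the
  empty list.\<close>

lemma flat_3:
  assumes "Q \<in> Multivectors 3"
  obtains h where "smooth h" "flat 3 Q = alt0 h"
proof
  let ?h = "\<lambda>x. flat 3 Q x []"
  show "smooth ?h"
    using assms unfolding smooth_alternating_def flat_def contract_def divide_inverse
    by (intro smooth_mult smooth_sum smooth_const) (auto simp: volume_form_def)
  show "flat 3 Q = alt0 ?h"
    by (auto simp: fun_eq_iff alt0_def flat_def volume_form_def contract_3 sum_Basis_3 det3_length)
qed

lemma flat_3_det3: "flat 3 (\<lambda>x us. h x * det3 us) = alt0 h"
  by (auto simp: fun_eq_iff alt0_def flat_def volume_form_def contract_3 sum_Basis_3 det3_length
      det3_triple coords_3)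

lemma inj_on_flat_1: "inj_on (flat 1) (Multivectors 1)"
  by (rule inj_onI, elim Forms_1E) (simp add: flat_1_alt1[unfolded One_nat_def] alt2_inject)

lemma inj_on_flat_2: "inj_on (flat 2) (Multivectors 2)"
  by (rule inj_onI, elim Forms_2E) (simp add: flat_2_alt2 alt1_inject)


section \<open>The canonical homology in degree two vanishes\<close>

text \<open>Gradient and curl: under the identifications \<open>alt0\<close>, \<open>alt1\<close>, \<open>alt2\<close> they are the exterior
  derivatives of functions and of 1-forms.\<close>

definition grad :: "(real^3 \<Rightarrow> real) \<Rightarrow> real^3 \<Rightarrow> real^3"
  where "grad h = (\<lambda>x. vector [frechet_derivative h (at x) e1, frechet_derivative h (at x) e2,
    frechet_derivative h (at x) e3])"

definition curl :: "(real^3 \<Rightarrow> real^3) \<Rightarrow> real^3 \<Rightarrow> real^3"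
  where "curl Y = (\<lambda>x. let D = frechet_derivative Y (at x) in
    vector [D e2 $ 3 - D e3 $ 2, D e3 $ 1 - D e1 $ 3, D e1 $ 2 - D e2 $ 1])"

lemma frechet_derivative_eq_grad:
  assumes "smooth h"
  shows "frechet_derivative h (at x) v = grad h x \<bullet> v"
proof -
  have "linear (frechet_derivative h (at x))"
    using smooth_differentiable[OF assms] linear_frechet_derivative by blast
  from linear_expand_3[OF this, of v] show ?thesis
    by (simp add: grad_def inner_3 mult.commute)
qed

lemma smooth_field_grad: "smooth h \<Longrightarrow> smooth_field (grad h)"
  by (simp add: smooth_field_def forall_3 grad_def smooth_frechet_derivative)

lemma smooth_field_curl: "smooth_field Y \<Longrightarrow> smooth_field (curl Y)"
  using smooth_field_derivative_const[of Y]
  by (simp add: smooth_field_def forall_3 curl_def Let_def smooth_diff)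

lemma length_omit: "i < length us \<Longrightarrow> length (omit i us) = length us - 1"
  by (simp add: omit_def)

lemma ext_deriv_alt0:
  assumes "smooth h"
  shows "ext_deriv (alt0 h) = alt1 (grad h)"
proof (intro ext)
  fix x and us :: "(real^3) list"
  show "ext_deriv (alt0 h) x us = alt1 (grad h) x us"
  proof (cases "length us = 1")
    case True
    then obtain u where "us = [u]" by (auto simp: length_Suc_conv)
    then show ?thesis
      by (simp add: ext_deriv_def omit_def alt0_def frechet_derivative_eq_grad[OF assms])
  next
    case False
    then have "omit i us \<noteq> []" if "i < length us" for i
      using that length_omit[OF that] by auto
    then show ?thesis
      using False by (simp add: ext_deriv_def alt0_def alt1_def frechet_derivative_const)
  qed
qed

lemma ext_deriv_alt1_pair:
  assumes "smooth_field Y"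
  shows "ext_deriv (alt1 Y) x [u, v]
    = frechet_derivative Y (at x) u \<bullet> v - frechet_derivative Y (at x) v \<bullet> u"
  by (simp add: ext_deriv_def omit_def lessThan_Suc frechet_derivative_inner_left[OF assms])

lemma ext_deriv_alt1:
  assumes "smooth_field Y"
  shows "ext_deriv (alt1 Y) = alt2 (curl Y)"
proof (intro ext)
  fix x and us :: "(real^3) list"
  show "ext_deriv (alt1 Y) x us = alt2 (curl Y) x us"
  proof (cases "length us = 2")
    case True
    then obtain u v where us: "us = [u, v]"
      using length_2_conv[THEN iffD1, of us] by blast
    note expand = linear_expand_3[OF linear_frechet_derivative_field[OF assms, of x]]
    show ?thesis
      unfolding us ext_deriv_alt1_pair[OF assms] expand[of u] expand[of v]
      by (simp add: curl_def Let_def coords_3 algebra_simps)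
  next
    case False
    then have "length (omit i us) \<noteq> 1" if "i < length us" for i
      using that length_omit[OF that] by auto
    then show ?thesis
      using False by (simp add: ext_deriv_def alt1_def alt2_def frechet_derivative_const)
  qed
qed

lemma flat_NP_boundary_2:
  assumes "smooth_field Y"
  shows "flat 1 (NP_boundary 2 (alt2 Y)) = alt2 (curl Y)"
proof -
  have "alt2 (curl Y) = flat 1 (alt1 (curl Y))"
    by (simp only: flat_1_alt1)
  also have "\<dots> \<in> flat 1 ` Multivectors 1"
    by (intro imageI alt1_in_Forms smooth_field_curl assms)
  finally have "alt2 (curl Y) \<in> flat 1 ` Multivectors 1" .
  from f_the_inv_into_f[OF inj_on_flat_1 this] show ?thesis
    by (simp add: NP_boundary_def flat_2_alt2 ext_deriv_alt1[OF assms])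
qed

lemma NP_boundary_3:
  assumes "flat 3 Q = alt0 h" "smooth h"
  shows "NP_boundary 3 Q = alt2 (grad h)"
  using the_inv_into_f_f[OF inj_on_flat_2 alt2_in_Forms[OF smooth_field_grad[OF assms(2)]]]
  by (simp add: NP_boundary_def assms ext_deriv_alt0 flat_2_alt2)

lemma sharp_Lambda_sing:
  "sharp Lambda_sing k \<beta> x us = (x \<bullet> x) * contract k \<beta> volume_form x us"
  by (simp add: sharp_def contract_def Lambda_sing_def volume_form_def inner_3 power2_eq_square
      sum_distrib_left mult.left_commute)

text \<open>The structure degenerates only at the origin; continuity carries vanishing over from the
  complement.\<close>

lemma continuous_zero_off_origin:
  fixes g :: "real^3 \<Rightarrow> real"
  assumes "continuous_on UNIV g" "\<And>x. x \<noteq> 0 \<Longrightarrow> g x = 0"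
  shows "g x = 0"
proof -
  have "(g \<longlongrightarrow> g 0) (at 0)"
    using assms(1) by (simp add: continuous_on_def)
  moreover have "(g \<longlongrightarrow> 0) (at 0)"
    using assms(2) by (intro tendsto_eventually) (simp add: eventually_at_filter)
  ultimately have "g 0 = 0"
    by (intro tendsto_unique[of "at (0::real^3)"]) auto
  then show ?thesis using assms(2) by metis
qed

lemma smooth_field_zero_off_origin:
  assumes "smooth_field Y" "\<And>x. x \<noteq> 0 \<Longrightarrow> Y x = 0"
  shows "Y = 0"
proof -
  have "Y x $ i = 0" for x i
    by (rule continuous_zero_off_origin) (use assms smooth_continuous in \<open>auto simp: smooth_field_def\<close>)
  then show ?thesis by (simp add: fun_eq_iff vec_eq_iff)
qed

lemma tangent_multivectors_sing: "tangent_multivectors Lambda_sing k = Multivectors k"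
proof -
  have "contract 1 \<alpha> P = 0" if "\<alpha> \<in> Forms 1" "sharp Lambda_sing 1 \<alpha> = 0" for \<alpha> P
  proof -
    obtain Y where Y: "smooth_field Y" and \<alpha>: "\<alpha> = alt1 Y"
      using \<open>\<alpha> \<in> Forms 1\<close> by (rule Forms_1E)
    have "contract 1 \<alpha> volume_form = alt2 Y"
      using flat_1_alt1 by (simp only: flat_def \<alpha>)
    then have "(x \<bullet> x) * alt2 Y x us = 0" for x us
      using fun_cong[OF fun_cong[OF that(2)], of x us] by (simp only: sharp_Lambda_sing zero_fun_apply)
    then have "x \<noteq> 0 \<Longrightarrow> Y x \<bullet> cross3 u v = 0" for x u v
      by (metis alt2_pair inner_eq_zero_iff mult_eq_0_iff)
    from this[of _ e2 e3] this[of _ e3 e1] this[of _ e1 e2] have "x \<noteq> 0 \<Longrightarrow> Y x = 0" for x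
      by (simp add: coords_3 vec_eq_iff forall_3)
    with Y have "Y = 0" by (rule smooth_field_zero_off_origin)
    then show ?thesis
      by (simp add: \<alpha> contract_1 fun_eq_iff)
  qed
  then show ?thesis by (auto simp: tangent_multivectors_def)
qed

lemma can_boundaries_2: "can_boundaries Lambda_sing 2 = (\<lambda>h. alt2 (grad h)) ` Collect smooth"
proof (intro equalityI subsetI)
  fix P assume "P \<in> can_boundaries Lambda_sing 2"
  then obtain Q where Q: "Q \<in> Multivectors 3" "P = NP_boundary 3 Q"
    by (auto simp: can_boundaries_def tangent_multivectors_sing)
  then show "P \<in> (\<lambda>h. alt2 (grad h)) ` Collect smooth"
    by (metis flat_3 NP_boundary_3 image_eqI mem_Collect_eq)
next
  fix P assume "P \<in> (\<lambda>h. alt2 (grad h)) ` Collect smooth"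
  then obtain h where h: "smooth h" "P = alt2 (grad h)" by blast
  then have "P = NP_boundary 3 (\<lambda>x us. h x * det3 us)"
    by (simp add: NP_boundary_3 flat_3_det3)
  then show "P \<in> can_boundaries Lambda_sing 2"
    using det3_in_Forms[OF h(1)] by (auto simp: can_boundaries_def tangent_multivectors_sing)
qed

text \<open>The boundary of the bivector field of \<open>Y\<close> corresponds to \<open>curl Y\<close>, so a cycle comes from a closed
  1-form and the Poincare lemma applies.\<close>

lemma can_cycles_2_subset: "can_cycles Lambda_sing 2 \<subseteq> can_boundaries Lambda_sing 2"
proof
  fix P assume "P \<in> can_cycles Lambda_sing 2"
  then have "P \<in> Multivectors 2" and bd: "NP_boundary 2 P = 0"
    by (simp_all add: can_cycles_def tangent_multivectors_sing)
  from this(1) obtain Y where Y: "smooth_field Y" and P: "P = alt2 Y"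
    by (rule Forms_2E)
  have "alt2 (curl Y) = flat 1 0"
    using flat_NP_boundary_2[OF Y] bd P by simp
  then have "ext_deriv (alt1 Y) = 0"
    by (simp add: ext_deriv_alt1[OF Y] flat_def contract_def zero_fun_def)
  then have "frechet_derivative Y (at x) u \<bullet> v = frechet_derivative Y (at x) v \<bullet> u" for x u v
    using ext_deriv_alt1_pair[OF Y, of x u v] by simp
  from Poincare_1_forms[OF Y this] obtain h
    where h: "smooth h" and Dh: "\<And>x. (h has_derivative (\<lambda>v. Y x \<bullet> v)) (at x)"
    by blast
  have "grad h x = Y x" for x
    using frechet_derivative_at[OF Dh, of x, symmetric]
    by (simp add: grad_def vec_eq_iff forall_3 inner_3)
  then have "grad h = Y" by blast
  then show "P \<in> can_boundaries Lambda_sing 2"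
    using h P by (auto simp: can_boundaries_2)
qed

lemma grad_add_scaled:
  assumes "smooth h" "smooth g"
  shows "grad (\<lambda>x. h x + c * g x) = (\<lambda>x. grad h x + c *\<^sub>R grad g x)"
proof
  fix x
  have "(h has_derivative frechet_derivative h (at x)) (at x)"
    "(g has_derivative frechet_derivative g (at x)) (at x)"
    using assms smooth_differentiable by (simp_all flip: frechet_derivative_works)
  then have "((\<lambda>x. h x + c * g x) has_derivative
      (\<lambda>v. frechet_derivative h (at x) v + c * frechet_derivative g (at x) v)) (at x)"
    by (auto intro!: derivative_eq_intros)
  from frechet_derivative_at[OF this, symmetric]
  show "grad (\<lambda>x. h x + c * g x) x = grad h x + c *\<^sub>R grad g x"
    by (simp add: grad_def vec_eq_iff forall_3)
qed

lemma H_canNP_2_trivial: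
  "quotient_space (can_cycles Lambda_sing 2) (can_boundaries Lambda_sing 2)
    \<subseteq> {can_boundaries Lambda_sing 2}"
proof -
  let ?B = "can_boundaries Lambda_sing 2"
  have comb: "(\<lambda>x us. P x us + c * Q x us) \<in> ?B" if PQ: "P \<in> ?B" "Q \<in> ?B" for c P Q
  proof -
    obtain h g where hg: "smooth h" "smooth g" and P: "P = alt2 (grad h)" and Q: "Q = alt2 (grad g)"
      using PQ by (auto simp: can_boundaries_2)
    have "(\<lambda>x us. P x us + c * Q x us) = alt2 (grad (\<lambda>x. h x + c * g x))"
      unfolding grad_add_scaled[OF hg] P Q by (simp add: fun_eq_iff alt2_def inner_simps)
    then show ?thesis
      using hg by (simp add: can_boundaries_2 smooth_add smooth_mult)
  qed
  have "P +o ?B = ?B" if P: "P \<in> ?B" for P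
  proof (intro equalityI subsetI)
    fix R assume "R \<in> P +o ?B"
    then show "R \<in> ?B"
      using comb[OF P, of _ 1] by (auto simp: elt_set_plus_def plus_fun_def)
  next
    fix R assume "R \<in> ?B"
    moreover have "R = P + (\<lambda>x us. R x us + (-1) * P x us)"
      by (simp add: fun_eq_iff)
    ultimately show "R \<in> P +o ?B"
      using comb[OF _ P, of R "-1"] unfolding elt_set_plus_def by blast
  qed
  then show ?thesis
    using can_cycles_2_subset by (auto simp: quotient_space_def)
qed


section \<open>The Nambu-Poisson cohomology in degree one does not vanish\<close>

lemma sharp_alt2: "sharp Lambda_sing 2 (alt2 Y) = (\<lambda>x us. (x \<bullet> x) * alt1 Y x us)"
  using flat_2_alt2[of Y, unfolded flat_def] by (simp add: fun_eq_iff sharp_Lambda_sing)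

text \<open>The kernel being zero, every class of 2-forms is a singleton, and its chosen representative is
  the form itself.\<close>

lemma ker_sharp_sing: "ker_sharp Lambda_sing = {0}"
proof (intro equalityI subsetI)
  fix \<alpha> assume "\<alpha> \<in> ker_sharp Lambda_sing"
  then have \<alpha>: "\<alpha> \<in> Forms 2" and 0: "sharp Lambda_sing 2 \<alpha> = 0"
    by (simp_all add: ker_sharp_def)
  from \<alpha> obtain Y where Y: "smooth_field Y" and \<alpha>: "\<alpha> = alt2 Y"
    by (rule Forms_2E)
  have "(x \<bullet> x) * alt1 Y x [Y x] = 0" for x
    using fun_cong[OF fun_cong[OF 0], of x "[Y x]"] by (simp add: \<alpha> sharp_alt2)
  then have "x = 0 \<or> Y x = 0" for x
    by simp
  with Y have "Y = 0"
    by (metis smooth_field_zero_off_origin)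
  then show "\<alpha> \<in> {0}"
    by (simp add: \<alpha> alt2_def fun_eq_iff)
next
  fix \<alpha> :: form assume "\<alpha> \<in> {0}"
  then show "\<alpha> \<in> ker_sharp Lambda_sing"
    by (simp add: ker_sharp_def sharp_def contract_def smooth_alternating_def
        alternating_multilinear_def linear_zero fun_eq_iff)
qed

lemma form_class_sing [simp]: "form_class Lambda_sing \<alpha> = {\<alpha>}"
  by (simp add: form_class_def ker_sharp_sing elt_set_plus_def)

lemma form_classes_sing: "form_classes Lambda_sing = (\<lambda>\<alpha>. {\<alpha>}) ` Forms 2"
  by (simp add: form_classes_def quotient_space_def flip: form_class_def)

lemma representative_singleton [simp]: "representative {\<alpha>} = \<alpha>"
  by (simp add: representative_def)

lemma anchor_alt2: "anchor Lambda_sing (alt2 Y) = (\<lambda>x. (x \<bullet> x) *\<^sub>R Y x)"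
  by (simp add: vector_field_def sharp_alt2 sum_Basis_3 fun_eq_iff vec_eq_iff forall_3 inner_3)

lemma sharp_3_ext_deriv_alt2:
  assumes "smooth_field Y"
  shows "sharp Lambda_sing 3 (ext_deriv (alt2 Y)) x [] = (x \<bullet> x) *
    (frechet_derivative Y (at x) e1 $ 1 + frechet_derivative Y (at x) e2 $ 2
      + frechet_derivative Y (at x) e3 $ 3)"
proof -
  have "ext_deriv (alt2 Y) x [a, b, c] = frechet_derivative Y (at x) a \<bullet> cross3 b c
      - frechet_derivative Y (at x) b \<bullet> cross3 a c + frechet_derivative Y (at x) c \<bullet> cross3 a b"
    for a b c
    by (simp add: ext_deriv_def omit_def lessThan_Suc numeral_2_eq_2
        frechet_derivative_inner_left[OF assms])
  then show ?thesis
    by (simp add: sharp_Lambda_sing contract_3 sum_Basis_3 volume_form_def det3_triple coords_3)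
qed

text \<open>In terms of vector fields the bracket is \<open>[r\<^sup>2 Y, Z] + Y(r\<^sup>2) Z\<close>: the divergence of \<open>r\<^sup>2 Y\<close>, which the Lie
  derivative produces on \<open>\<nu>\<close>, cancels against \<open>#\<^sub>3(d\<alpha>) = r\<^sup>2 div Y\<close> up to \<open>Y(r\<^sup>2) = 2 x \<bullet> Y\<close>.\<close>

lemma leibniz_bracket_alt2:
  assumes Y: "smooth_field Y" and Z: "smooth_field Z"
  shows "leibniz_bracket Lambda_sing (alt2 Y) (alt2 Z) = alt2 (\<lambda>x.
    (x \<bullet> x) *\<^sub>R (frechet_derivative Z (at x) (Y x) - frechet_derivative Y (at x) (Z x))
    + (2 * (x \<bullet> Y x)) *\<^sub>R Z x - (2 * (x \<bullet> Z x)) *\<^sub>R Y x)" (is "_ = alt2 ?W")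
proof (intro ext)
  fix x and us :: "(real^3) list"
  show "leibniz_bracket Lambda_sing (alt2 Y) (alt2 Z) x us = alt2 ?W x us"
  proof (cases "length us = 2")
    case False
    then show ?thesis
      by (simp add: leibniz_bracket_def lie_deriv_def deriv_along_def alt2_def
          frechet_derivative_const)
  next
    case True
    then obtain u v where us: "us = [u, v]"
      using length_2_conv[THEN iffD1, of us] by blast
    let ?D = "frechet_derivative Y (at x)" and ?E = "frechet_derivative Z (at x)"
    have DY: "(Y has_derivative ?D) (at x)"
      by (rule smooth_field_has_derivative[OF Y])
    have "((\<lambda>x. (x \<bullet> x) *\<^sub>R Y x) has_derivative
        (\<lambda>w. (x \<bullet> x) *\<^sub>R ?D w + (2 * (x \<bullet> w)) *\<^sub>R Y x)) (at x)"
      using DY by (auto intro!: derivative_eq_intros simp: inner_commute)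
    from frechet_derivative_at[OF this, symmetric]
    have br: "lie_bracket (\<lambda>x. (x \<bullet> x) *\<^sub>R Y x) (\<lambda>_. w) x
        = - ((x \<bullet> x) *\<^sub>R ?D w + (2 * (x \<bullet> w)) *\<^sub>R Y x)" for w
      by (simp add: lie_bracket_def frechet_derivative_const)
    note expand = linear_expand_3[OF linear_frechet_derivative_field[OF Y, of x]]
    have "leibniz_bracket Lambda_sing (alt2 Y) (alt2 Z) x [u, v]
      = (x \<bullet> x) * (?E (Y x) \<bullet> cross3 u v)
        - (Z x \<bullet> cross3 (- ((x \<bullet> x) *\<^sub>R ?D u + (2 * (x \<bullet> u)) *\<^sub>R Y x)) v
          + Z x \<bullet> cross3 u (- ((x \<bullet> x) *\<^sub>R ?D v + (2 * (x \<bullet> v)) *\<^sub>R Y x)))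
        - (x \<bullet> x) * (?D e1 $ 1 + ?D e2 $ 2 + ?D e3 $ 3) * (Z x \<bullet> cross3 u v)"
      unfolding leibniz_bracket_def lie_deriv_def anchor_alt2 sharp_3_ext_deriv_alt2[OF Y]
      by (simp add: deriv_along_def frechet_derivative_inner_left[OF Z] lessThan_Suc br
          linear_scale[OF linear_frechet_derivative_field[OF Z]])
    \<comment> \<open>For a matrix \<open>A\<close>, \<open>z \<bullet> (A u \<times> v + u \<times> A v) = (tr A) z \<bullet> (u \<times> v) - A z \<bullet> (u \<times> v)\<close>; here \<open>A\<close> is the
      derivative of \<open>r\<^sup>2 Y\<close>. In coordinates this is a polynomial identity.\<close>
    also have "\<dots> = ?W x \<bullet> cross3 u v"
      unfolding expand[of u] expand[of v] expand[of "Z x"]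
      by (simp add: coords_3) algebra
    finally show ?thesis by (simp add: us)
  qed
qed


text \<open>The cochain of the 1-form \<open>d(r\<^sup>2)\<close>, taking the class of \<open>i(Y)\<nu>\<close> to \<open>Y(r\<^sup>2) = 2 x \<bullet> Y\<close>.\<close>

definition radial_cochain :: cochain
  where "radial_cochain As = (\<lambda>x. if length As = 1 \<and> set As \<subseteq> form_classes Lambda_sing
    then 2 * (x \<bullet> hodge (representative (As ! 0)) x) else 0)"

lemma radial_cochain_alt2:
  "smooth_field Y \<Longrightarrow> radial_cochain [{alt2 Y}] = (\<lambda>x. 2 * (x \<bullet> Y x))"
  by (simp add: radial_cochain_def form_classes_sing alt2_in_Forms)

lemma smooth_radial_cochain: "smooth (radial_cochain As)"
proof (cases "length As = 1 \<and> set As \<subseteq> form_classes Lambda_sing")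
  case True
  then obtain Y where "smooth_field Y" "As = [{alt2 Y}]"
    by (auto simp: length_Suc_conv form_classes_sing elim!: Forms_2E)
  then show ?thesis
    by (simp add: radial_cochain_alt2 smooth_mult smooth_inner smooth_field_id)
next
  case False
  then have "radial_cochain As = (\<lambda>x. 0)"
    by (simp only: radial_cochain_def if_False)
  then show ?thesis by simp
qed

lemma radial_cochain_in_cochains: "radial_cochain \<in> cochains Lambda_sing 1"
  unfolding cochains_def
proof (intro CollectI conjI allI impI)
  fix As :: "form set list"
  assume "\<not> (length As = 1 \<and> set As \<subseteq> form_classes Lambda_sing)"
  then show "radial_cochain As = 0"
    by (simp only: radial_cochain_def zero_fun_def if_False)
next
  fix As show "smooth (radial_cochain As)" by (rule smooth_radial_cochain)
next
  fix As :: "form set list" and i :: nat and \<alpha> \<beta>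
  assume *: "length As = 1 \<and> set As \<subseteq> form_classes Lambda_sing \<and> i < 1
    \<and> \<alpha> \<in> Forms 2 \<and> \<beta> \<in> Forms 2"
  obtain Y where Y: "smooth_field Y" "\<alpha> = alt2 Y"
    using * by (auto elim: Forms_2E)
  obtain Z where Z: "smooth_field Z" "\<beta> = alt2 Z"
    using * by (auto elim: Forms_2E)
  have upd: "As[i := B] = [B]" for B
    using * by (auto simp: length_Suc_conv)
  have sum: "alt2 Y + alt2 Z = alt2 (\<lambda>x. Y x + Z x)"
    by (simp add: fun_eq_iff alt2_def inner_add_left)
  show "radial_cochain (As[i := form_class Lambda_sing (\<alpha> + \<beta>)])
      = radial_cochain (As[i := form_class Lambda_sing \<alpha>])
        + radial_cochain (As[i := form_class Lambda_sing \<beta>])"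
    unfolding upd form_class_sing Y(2) Z(2) sum
    using Y(1) Z(1)
    by (simp add: radial_cochain_alt2 smooth_field_add plus_fun_def inner_add_right distrib_left)
next
  fix As :: "form set list" and i :: nat and f \<alpha>
  assume *: "length As = 1 \<and> set As \<subseteq> form_classes Lambda_sing \<and> i < 1 \<and> smooth f \<and> \<alpha> \<in> Forms 2"
  obtain Y where Y: "smooth_field Y" "\<alpha> = alt2 Y"
    using * by (auto elim: Forms_2E)
  have upd: "As[i := B] = [B]" for B
    using * by (auto simp: length_Suc_conv)
  have scaled: "(\<lambda>x us. f x * alt2 Y x us) = alt2 (\<lambda>x. f x *\<^sub>R Y x)"
    by (simp add: fun_eq_iff alt2_def)
  show "radial_cochain (As[i := form_class Lambda_sing (\<lambda>x us. f x * \<alpha> x us)])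
      = (\<lambda>x. f x * radial_cochain (As[i := form_class Lambda_sing \<alpha>]) x)"
    unfolding upd form_class_sing Y(2) scaled
    using Y(1) * by (simp add: radial_cochain_alt2 smooth_field_scaleR mult.left_commute)
qed simp

lemma radial_cochain_cocycle: "radial_cochain \<in> NP_cocycles Lambda_sing 1"
proof -
  have "NP_coboundary Lambda_sing 1 radial_cochain As x = 0" for As x
  proof (cases "length As = 2 \<and> set As \<subseteq> form_classes Lambda_sing")
    case False
    then show ?thesis by (auto simp: NP_coboundary_def)
  next
    case True
    then obtain A B where "As = [A, B]" "A \<in> form_classes Lambda_sing" "B \<in> form_classes Lambda_sing"
      using length_2_conv[THEN iffD1, of As] by auto
    then obtain Y Z where Y: "smooth_field Y" and Z: "smooth_field Z" and As: "As = [{alt2 Y}, {alt2 Z}]"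
      by (auto simp: form_classes_sing elim!: Forms_2E)
    let ?D = "frechet_derivative Y (at x)" and ?E = "frechet_derivative Z (at x)"
    let ?W = "\<lambda>x. (x \<bullet> x) *\<^sub>R (frechet_derivative Z (at x) (Y x) - frechet_derivative Y (at x) (Z x))
      + (2 * (x \<bullet> Y x)) *\<^sub>R Z x - (2 * (x \<bullet> Z x)) *\<^sub>R Y x"
    have W: "smooth_field ?W"
      using Y Z by (intro smooth_field_diff smooth_field_add smooth_field_scaleR smooth_mult
          smooth_inner smooth_field_id smooth_field_derivative smooth_const)
    have D: "deriv_along (\<lambda>x. (x \<bullet> x) *\<^sub>R U x) (\<lambda>x. 2 * (x \<bullet> V x)) x
        = 2 * (x \<bullet> x) * (U x \<bullet> V x + x \<bullet> frechet_derivative V (at x) (U x))"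
      if V: "smooth_field V" for U V
    proof -
      have "((\<lambda>x. 2 * (x \<bullet> V x)) has_derivative
          (\<lambda>v. 2 * (x \<bullet> frechet_derivative V (at x) v + v \<bullet> V x))) (at x)"
        using smooth_field_has_derivative[OF V, of x] by (auto intro!: derivative_eq_intros)
      from frechet_derivative_at[OF this, symmetric] show ?thesis
        by (simp add: deriv_along_def linear_scale[OF linear_frechet_derivative_field[OF V]]
            algebra_simps)
    qed
    have "NP_coboundary Lambda_sing 1 radial_cochain As x
      = deriv_along (\<lambda>x. (x \<bullet> x) *\<^sub>R Y x) (\<lambda>x. 2 * (x \<bullet> Z x)) x
        - deriv_along (\<lambda>x. (x \<bullet> x) *\<^sub>R Z x) (\<lambda>x. 2 * (x \<bullet> Y x)) x
        - 2 * (x \<bullet> ?W x)"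
      using Y Z W
      by (simp add: NP_coboundary_def As form_classes_sing alt2_in_Forms omit_def lessThan_Suc atMost_Suc
        anchor_alt2 leibniz_bracket_alt2 radial_cochain_alt2)
    also have "\<dots> = 0"
      by (simp add: D Y Z inner_simps inner_commute algebra_simps)
    finally show ?thesis .
  qed
  then show ?thesis
    using radial_cochain_in_cochains by (simp add: NP_cocycles_def fun_eq_iff)
qed

lemma radial_cochain_not_coboundary: "radial_cochain \<notin> NP_coboundaries Lambda_sing 1"
proof
  assume "radial_cochain \<in> NP_coboundaries Lambda_sing 1"
  then obtain c where c: "c \<in> cochains Lambda_sing 0"
    and eq: "radial_cochain = NP_coboundary Lambda_sing 0 c"
    by (auto simp: NP_coboundaries_def)
  have h: "smooth (c [])"
    using c by (simp add: cochains_def)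
  \<comment> \<open>Evaluate \<open>d(r\<^sup>2) = r\<^sup>2 dh\<close>, where \<open>h = c []\<close>, on \<open>\<partial>/\<partial>x\<^sub>1\<close> along the first axis.\<close>
  define g where "g x = frechet_derivative (c []) (at x) e1" for x
  have "continuous_on UNIV g"
    unfolding g_def by (intro smooth_continuous smooth_frechet_derivative h)
  then have "continuous_on UNIV (\<lambda>t. g (t *\<^sub>R e1))"
    by (rule continuous_on_compose2) (auto intro!: continuous_intros)
  then have "continuous_on UNIV (\<lambda>t. t * g (t *\<^sub>R e1))"
    by (intro continuous_on_mult continuous_on_id)
  then have "isCont (\<lambda>t. t * g (t *\<^sub>R e1)) 0"
    by (simp add: continuous_on_eq_continuous_at)
  then have "((\<lambda>t. t * g (t *\<^sub>R e1)) \<longlongrightarrow> 0) (at 0)"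
    by (simp add: isCont_def)
  moreover have "t * g (t *\<^sub>R e1) = 2" if "t \<noteq> 0" for t
  proof -
    have lin: "linear (frechet_derivative (c []) (at x))" for x
      using smooth_differentiable[OF h] linear_frechet_derivative by blast
    have "2 * t = (t * t) * g (t *\<^sub>R e1)"
      using fun_cong[OF fun_cong[OF eq], of "[{alt2 (\<lambda>_. e1)}]" "t *\<^sub>R e1"]
      by (simp add: radial_cochain_alt2 NP_coboundary_def form_classes_sing alt2_in_Forms omit_def
        anchor_alt2 deriv_along_def linear_scale[OF lin] g_def inner_3)
    then show ?thesis using that by simp
  qed
  then have "((\<lambda>t. t * g (t *\<^sub>R e1)) \<longlongrightarrow> 2) (at 0)"
    by (intro tendsto_eventually) (simp add: eventually_at_filter)
  ultimately show False
    using tendsto_unique[of "at (0::real)"] by fastforce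
qed

lemma zero_cochain: "0 \<in> cochains \<Lambda> k"
  by (simp add: cochains_def fun_eq_iff)

lemma NP_coboundary_zero: "NP_coboundary \<Lambda> k 0 = 0"
  by (simp add: NP_coboundary_def deriv_along_def zero_fun_def frechet_derivative_const
      cong: if_cong)

lemma zero_cocycle: "0 \<in> NP_cocycles \<Lambda> k"
  by (simp add: NP_cocycles_def zero_cochain NP_coboundary_zero)

lemma zero_coboundary: "0 \<in> NP_coboundaries \<Lambda> k"
  using imageI[OF zero_cochain, of "NP_coboundary \<Lambda> (k - 1)"]
  by (simp add: NP_coboundaries_def NP_coboundary_zero)

theorem mainTheorem8:
  shows "\<not> (H_NP Lambda_sing 1 \<cong> H_canNP Lambda_sing 2)
    \<and> \<not> (\<forall>k\<le>3. H_NP Lambda_sing k \<cong> H_canNP Lambda_sing (3 - k))"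
proof -
  have not_iso: "\<not> (H_NP Lambda_sing 1 \<cong> H_canNP Lambda_sing 2)"
  proof
    let ?Z = "NP_cocycles Lambda_sing 1" and ?B = "NP_coboundaries Lambda_sing 1"
    assume "H_NP Lambda_sing 1 \<cong> H_canNP Lambda_sing 2"
    then obtain \<phi> where "bij_betw \<phi> (quotient_space ?Z ?B)
        (quotient_space (can_cycles Lambda_sing 2) (can_boundaries Lambda_sing 2))"
      by (auto simp: isomorphic_quotients_def H_NP_def H_canNP_def)
    \<comment> \<open>Bijectivity alone suffices: the target has at most one class, the source at least two.\<close>
    then have inj: "inj_on \<phi> (quotient_space ?Z ?B)"
      and const: "\<And>X. X \<in> quotient_space ?Z ?B \<Longrightarrow> \<phi> X = can_boundaries Lambda_sing 2"
      using H_canNP_2_trivial by (auto simp: bij_betw_def)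
    have "c +o ?B \<in> quotient_space ?Z ?B" if "c \<in> ?Z" for c
      unfolding quotient_space_def using that by (rule imageI)
    from this[OF radial_cochain_cocycle] this[OF zero_cocycle] have "radial_cochain +o ?B = 0 +o ?B"
      using inj const by (metis inj_onD)
    moreover have "radial_cochain \<in> radial_cochain +o ?B"
      using zero_coboundary by (force simp: elt_set_plus_def)
    ultimately have "radial_cochain \<in> ?B"
      by (simp add: elt_set_plus_def)
    then show False
      using radial_cochain_not_coboundary by blast
  qed
  moreover have "H_NP Lambda_sing 1 \<cong> H_canNP Lambda_sing 2"
    if "\<forall>k\<le>3. H_NP Lambda_sing k \<cong> H_canNP Lambda_sing (3 - k)"
    using that[rule_format, of 1] by simp
  ultimately show ?thesis by blast
qed

end
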